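(* Let $\Omega\subset\mathbb R^N$ be a bounded domain which is convex or of class $C^2$, $\nu,\kappa>0$, $(u_0,v_0)\in\mathcal H=H^1_0(\Omega)\times L^2(\Omega)$, and let $\mathcal F:L^2(\Omega)\to L^2(\Omega)$ be continuous and map bounded sets to bounded sets. Suppose that $\mathcal G:\mathcal H\to\mathbb R$ is a continuous functional with $\mathcal G(u_0,v_0)>0$. Then for any maximal solution $u$, defined on $[0,\tau)$, of $$u_{tt}=-\nu u_t+\kappa\nabla^2u+\mathcal F(u),\quad u=0\text{ on }\partial\Omega,\quad(u,u_t)|_{t=0}=(u_0,v_0),$$ there is a positive number $\tau'\le\tau$ (possibly infinite) such that $[0,\tau')$ is maximal for the constraint $\mathcal G(u(t),u_t(t))>0$, i.e. the constraint holds for all $t\in[0,\tau')$ and $[0,\tau')$ is the largest such subinterval of $[0,\tau)$. In particular, if $\tau'<\tau$, the constraint fails at $t=\tau'$.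
   Context: $\mathcal H$ carries the usual product Hilbert space topology of $H^1_0(\Omega)\times L^2(\Omega)$. Weak solution on $J=[0,T_1]$: a function $u$ with $(u,u_t)\in C(J;\mathcal H)$, $u_{tt}\in C(J;H^{-1}(\Omega))$, $(u(0),u_t(0))=(u_0,v_0)$, and for all $\phi\in C(J;H^1_0(\Omega))$ and $0<t\le T_1$: $(u_{tt},\phi)_{L^2}=-\nu(u_t,\phi)_{L^2}-\kappa(\nabla u,\nabla\phi)_{L^2}+(\mathcal F(u),\phi)_{L^2}$ (the left side being the $H^{-1}$–$H^1_0$ pairing). A function on $[0,\tau)$, $0<\tau\le\infty$, whose restriction to every compact $[0,T_1]\subset[0,\tau)$ is a weak solution is called a maximal solution if it has no proper extension which is a weak solution. *)

theory Defs
  imports "HOL-Analysis.Analysis"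
begin

text \<open>
  Elements of function spaces are represented by functions, not by classes modulo equality almost
  everywhere; the distances below are therefore pseudometrics. A map that is continuous with
  respect to them sends points at distance 0 to points at distance 0, so it descends to the
  classes.
\<close>

definition continuous_between ::
  "'x set \<Rightarrow> ('x \<Rightarrow> 'x \<Rightarrow> real) \<Rightarrow> 'y set \<Rightarrow> ('y \<Rightarrow> 'y \<Rightarrow> real) \<Rightarrow> ('x \<Rightarrow> 'y) \<Rightarrow> bool" where
  "continuous_between X dX Y dY f \<longleftrightarrow>
     (\<forall>x\<in>X. f x \<in> Y) \<and>
     (\<forall>x\<in>X. \<forall>\<epsilon>>0. \<exists>\<delta>>0. \<forall>y\<in>X. dX y x < \<delta> \<longrightarrow> dY (f y) (f x) < \<epsilon>)"

text \<open>
  Norm derivative of a curve in a space of real functions (or functionals) \<open>X\<close> with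
  distance \<open>d\<close>; one-sided at endpoints of \<open>J\<close>.
\<close>

definition has_time_derivative ::
  "('x \<Rightarrow> real) set \<Rightarrow> (('x \<Rightarrow> real) \<Rightarrow> ('x \<Rightarrow> real) \<Rightarrow> real) \<Rightarrow> real set
     \<Rightarrow> (real \<Rightarrow> 'x \<Rightarrow> real) \<Rightarrow> (real \<Rightarrow> 'x \<Rightarrow> real) \<Rightarrow> bool" where
  "has_time_derivative X d J u v \<longleftrightarrow>
     (\<forall>t\<in>J. u t \<in> X \<and> v t \<in> X \<and>
        ((\<lambda>s. d (\<lambda>x. (u s x - u t x) / (s - t)) (v t)) \<longlongrightarrow> 0) (at t within J))"

subsection \<open>Smoothness\<close>

primrec C_k :: "nat \<Rightarrow> ('a::euclidean_space \<Rightarrow> real) \<Rightarrow> bool" where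
  "C_k 0 f \<longleftrightarrow> continuous_on UNIV f"
| "C_k (Suc k) f \<longleftrightarrow>
     (\<forall>x. f differentiable (at x)) \<and>
     (\<forall>i\<in>Basis. C_k k (\<lambda>x. frechet_derivative f (at x) i))"

definition gradient :: "('a::euclidean_space \<Rightarrow> real) \<Rightarrow> 'a \<Rightarrow> 'a" where
  "gradient f x = (\<Sum>i\<in>Basis. frechet_derivative f (at x) i *\<^sub>R i)"

definition test_functions :: "'a::euclidean_space set \<Rightarrow> ('a \<Rightarrow> real) set" where
  "test_functions \<Omega> = {\<phi>. (\<forall>k. C_k k \<phi>) \<and>
     compact (closure {x. \<phi> x \<noteq> 0}) \<and> closure {x. \<phi> x \<noteq> 0} \<subseteq> \<Omega>}"

text \<open>
  Near every boundary point, \<open>\<Omega>\<close> is the region above the graph of a \<open>C\<^sup>2\<close> function in some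
  rotated coordinate system. The unit vector \<open>e\<close> is the vertical direction, and
  \<open>x - (x \<bullet> e) *\<^sub>R e\<close> is the projection of \<open>x\<close> to the hyperplane orthogonal to \<open>e\<close>, so only the
  values of \<open>\<gamma>\<close> on that hyperplane matter.
\<close>

definition C2_domain :: "'a::euclidean_space set \<Rightarrow> bool" where
  "C2_domain \<Omega> \<longleftrightarrow>
     (\<forall>p\<in>frontier \<Omega>. \<exists>r>0. \<exists>e \<gamma>. norm e = 1 \<and> C_k 2 \<gamma> \<and>
        \<Omega> \<inter> ball p r = {x \<in> ball p r. \<gamma> (x - (x \<bullet> e) *\<^sub>R e) < x \<bullet> e})"

subsection \<open>Function spaces\<close>

definition L2 :: "'a::euclidean_space set \<Rightarrow> ('a \<Rightarrow> 'b::euclidean_space) set" where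
  "L2 \<Omega> = {f \<in> borel_measurable (lebesgue_on \<Omega>). integrable (lebesgue_on \<Omega>) (\<lambda>x. (norm (f x))\<^sup>2)}"

definition L2_inner ::
  "'a::euclidean_space set \<Rightarrow> ('a \<Rightarrow> 'b::euclidean_space) \<Rightarrow> ('a \<Rightarrow> 'b) \<Rightarrow> real" where
  "L2_inner \<Omega> f g = (\<integral>x. f x \<bullet> g x \<partial>lebesgue_on \<Omega>)"

definition L2_norm :: "'a::euclidean_space set \<Rightarrow> ('a \<Rightarrow> 'b::euclidean_space) \<Rightarrow> real" where
  "L2_norm \<Omega> f = sqrt (L2_inner \<Omega> f f)"

definition L2_dist ::
  "'a::euclidean_space set \<Rightarrow> ('a \<Rightarrow> 'b::euclidean_space) \<Rightarrow> ('a \<Rightarrow> 'b) \<Rightarrow> real" where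
  "L2_dist \<Omega> f g = L2_norm \<Omega> (\<lambda>x. f x - g x)"

text \<open>\<open>f \<in> H\<^sup>1(\<Omega>)\<close> with weak gradient \<open>g\<close>.\<close>

definition H1_gradient ::
  "'a::euclidean_space set \<Rightarrow> ('a \<Rightarrow> real) \<Rightarrow> ('a \<Rightarrow> 'a) \<Rightarrow> bool" where
  "H1_gradient \<Omega> f g \<longleftrightarrow> f \<in> L2 \<Omega> \<and> g \<in> L2 \<Omega> \<and>
     (\<forall>\<psi>\<in>test_functions \<Omega>. \<forall>i\<in>Basis.
        L2_inner \<Omega> f (\<lambda>x. gradient \<psi> x \<bullet> i) = - L2_inner \<Omega> (\<lambda>x. g x \<bullet> i) \<psi>)"

text \<open>\<open>f\<close> is moreover an \<open>H\<^sup>1\<close>-limit of test functions.\<close>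

definition H10_gradient ::
  "'a::euclidean_space set \<Rightarrow> ('a \<Rightarrow> real) \<Rightarrow> ('a \<Rightarrow> 'a) \<Rightarrow> bool" where
  "H10_gradient \<Omega> f g \<longleftrightarrow> H1_gradient \<Omega> f g \<and>
     (\<exists>\<phi>::nat \<Rightarrow> 'a \<Rightarrow> real. (\<forall>k. \<phi> k \<in> test_functions \<Omega>) \<and>
        (\<lambda>k. L2_dist \<Omega> (\<phi> k) f) \<longlonglongrightarrow> 0 \<and>
        (\<lambda>k. L2_dist \<Omega> (gradient (\<phi> k)) g) \<longlonglongrightarrow> 0)"

definition H10 :: "'a::euclidean_space set \<Rightarrow> ('a \<Rightarrow> real) set" where
  "H10 \<Omega> = {f. \<exists>g. H10_gradient \<Omega> f g}"

text \<open>Unique up to null sets for \<open>f \<in> H10 \<Omega>\<close>; not meaningful for other \<open>f\<close>.\<close>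

definition weak_gradient :: "'a::euclidean_space set \<Rightarrow> ('a \<Rightarrow> real) \<Rightarrow> 'a \<Rightarrow> 'a" where
  "weak_gradient \<Omega> f = (SOME g. H10_gradient \<Omega> f g)"

definition H1_norm :: "'a::euclidean_space set \<Rightarrow> ('a \<Rightarrow> real) \<Rightarrow> real" where
  "H1_norm \<Omega> f = sqrt ((L2_norm \<Omega> f)\<^sup>2 + (L2_norm \<Omega> (weak_gradient \<Omega> f))\<^sup>2)"

definition H1_dist :: "'a::euclidean_space set \<Rightarrow> ('a \<Rightarrow> real) \<Rightarrow> ('a \<Rightarrow> real) \<Rightarrow> real" where
  "H1_dist \<Omega> f g = H1_norm \<Omega> (\<lambda>x. f x - g x)"

definition energy_space :: "'a::euclidean_space set \<Rightarrow> (('a \<Rightarrow> real) \<times> ('a \<Rightarrow> real)) set" where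
  "energy_space \<Omega> = H10 \<Omega> \<times> L2 \<Omega>"

definition energy_dist :: "'a::euclidean_space set
    \<Rightarrow> ('a \<Rightarrow> real) \<times> ('a \<Rightarrow> real) \<Rightarrow> ('a \<Rightarrow> real) \<times> ('a \<Rightarrow> real) \<Rightarrow> real" where
  "energy_dist \<Omega> p q =
     sqrt ((H1_dist \<Omega> (fst p) (fst q))\<^sup>2 + (L2_dist \<Omega> (snd p) (snd q))\<^sup>2)"

text \<open>
  \<open>H\<^sup>-\<^sup>1(\<Omega>)\<close>, the dual of \<open>H\<^sup>1\<^sub>0(\<Omega>)\<close>. Only the values of a functional on \<open>H10 \<Omega>\<close> matter.
  \<open>L2_inner \<Omega> v\<close> is the image of \<open>v \<in> L2 \<Omega>\<close> under the usual embedding.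
\<close>

definition Hminus1 :: "'a::euclidean_space set \<Rightarrow> (('a \<Rightarrow> real) \<Rightarrow> real) set" where
  "Hminus1 \<Omega> = {l.
     (\<forall>f\<in>H10 \<Omega>. \<forall>g\<in>H10 \<Omega>. \<forall>a b. l (\<lambda>x. a * f x + b * g x) = a * l f + b * l g) \<and>
     (\<exists>C. \<forall>f\<in>H10 \<Omega>. \<bar>l f\<bar> \<le> C * H1_norm \<Omega> f)}"

definition Hminus1_dist ::
  "'a::euclidean_space set \<Rightarrow> (('a \<Rightarrow> real) \<Rightarrow> real) \<Rightarrow> (('a \<Rightarrow> real) \<Rightarrow> real) \<Rightarrow> real" where
  "Hminus1_dist \<Omega> l m = (SUP f \<in> {f \<in> H10 \<Omega>. H1_norm \<Omega> f \<le> 1}. \<bar>l f - m f\<bar>)"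

subsection \<open>Solutions\<close>

definition weak_solution ::
  "'a::euclidean_space set \<Rightarrow> real \<Rightarrow> real \<Rightarrow> (('a \<Rightarrow> real) \<Rightarrow> 'a \<Rightarrow> real)
     \<Rightarrow> ('a \<Rightarrow> real) \<Rightarrow> ('a \<Rightarrow> real) \<Rightarrow> real \<Rightarrow> (real \<Rightarrow> 'a \<Rightarrow> real) \<Rightarrow> bool" where
  "weak_solution \<Omega> \<nu> \<kappa> F u0 v0 T u \<longleftrightarrow> 0 < T \<and>
     (\<exists>ut utt.
        has_time_derivative (L2 \<Omega>) (L2_dist \<Omega>) {0..T} u ut \<and>
        continuous_between {0..T} dist (energy_space \<Omega>) (energy_dist \<Omega>) (\<lambda>t. (u t, ut t)) \<and>
        has_time_derivative (Hminus1 \<Omega>) (Hminus1_dist \<Omega>) {0..T} (\<lambda>t. L2_inner \<Omega> (ut t)) utt \<and>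
        continuous_between {0..T} dist (Hminus1 \<Omega>) (Hminus1_dist \<Omega>) utt \<and>
        (AE x in lebesgue_on \<Omega>. u 0 x = u0 x) \<and>
        (AE x in lebesgue_on \<Omega>. ut 0 x = v0 x) \<and>
        (\<forall>\<phi>. continuous_between {0..T} dist (H10 \<Omega>) (H1_dist \<Omega>) \<phi> \<longrightarrow>
           (\<forall>t\<in>{0<..T}. utt t (\<phi> t) =
              - \<nu> * L2_inner \<Omega> (ut t) (\<phi> t)
              - \<kappa> * L2_inner \<Omega> (weak_gradient \<Omega> (u t)) (weak_gradient \<Omega> (\<phi> t))
              + L2_inner \<Omega> (F (u t)) (\<phi> t))))"

definition initial_interval :: "ereal \<Rightarrow> real set" where
  "initial_interval \<tau> = {t. 0 \<le> t \<and> ereal t < \<tau>}"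

text \<open>
  Proper extensions to \<open>[0, \<sigma>)\<close> with \<open>\<sigma> > \<tau>\<close> restrict to proper extensions to some \<open>[0, T]\<close>
  with \<open>T \<ge> \<tau>\<close>, so it suffices to exclude the latter.
\<close>

definition maximal_solution ::
  "'a::euclidean_space set \<Rightarrow> real \<Rightarrow> real \<Rightarrow> (('a \<Rightarrow> real) \<Rightarrow> 'a \<Rightarrow> real)
     \<Rightarrow> ('a \<Rightarrow> real) \<Rightarrow> ('a \<Rightarrow> real) \<Rightarrow> ereal \<Rightarrow> (real \<Rightarrow> 'a \<Rightarrow> real) \<Rightarrow> bool" where
  "maximal_solution \<Omega> \<nu> \<kappa> F u0 v0 \<tau> u \<longleftrightarrow> 0 < \<tau> \<and>
     (\<forall>T>0. ereal T < \<tau> \<longrightarrow> weak_solution \<Omega> \<nu> \<kappa> F u0 v0 T u) \<and>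
     \<not> (\<exists>T w. \<tau> \<le> ereal T \<and> weak_solution \<Omega> \<nu> \<kappa> F u0 v0 T w \<and>
          (\<forall>t\<in>initial_interval \<tau>. AE x in lebesgue_on \<Omega>. w t x = u t x))"

end

theory Submission
  imports Defs
begin

text \<open>
  The functional evaluated along the solution, \<open>t \<mapsto> G (u t, ut t)\<close>, is a continuous real function
  which is positive at \<open>0\<close>, so \<open>\<tau>'\<close> is its first zero, or \<open>\<tau>\<close> if there is none. What needs care
  is that function spaces carry only pseudometrics: \<open>ut\<close> agrees merely almost everywhere with the
  derivative supplied by each weak solution, and the weak gradient is chosen arbitrarily, so one
  has to see that functions agreeing almost everywhere are at distance \<open>0\<close> in the energy space.
\<close>

section \<open>Square-integrable functions, their pseudometric and uniqueness of limits\<close>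

lemma norm_diff_power2_le:
  fixes a b :: "'a::real_inner"
  shows "(norm (a - b))\<^sup>2 \<le> 2 * (norm a)\<^sup>2 + 2 * (norm b)\<^sup>2"
  \<comment> \<open>By the parallelogram law, the right side minus the left side is the squared norm
    of \<open>a + b\<close>.\<close>
  using inner_ge_zero[of "a + b"]
  by (simp add: power2_norm_eq_inner inner_add_left inner_add_right inner_diff_left
      inner_diff_right inner_commute)

lemma L2_diff:
  fixes f g :: "'a::euclidean_space \<Rightarrow> 'b::euclidean_space"
  assumes "f \<in> L2 \<Omega>" "g \<in> L2 \<Omega>"
  shows "(\<lambda>x. f x - g x) \<in> L2 \<Omega>"
proof -
  have m [measurable]: "f \<in> borel_measurable (lebesgue_on \<Omega>)" "g \<in> borel_measurable (lebesgue_on \<Omega>)"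
    and i: "integrable (lebesgue_on \<Omega>) (\<lambda>x. (norm (f x))\<^sup>2)" "integrable (lebesgue_on \<Omega>) (\<lambda>x. (norm (g x))\<^sup>2)"
    using assms by (auto simp: L2_def)
  have "integrable (lebesgue_on \<Omega>) (\<lambda>x. (norm (f x - g x))\<^sup>2)"
  proof (rule Bochner_Integration.integrable_bound)
    show "integrable (lebesgue_on \<Omega>) (\<lambda>x. 2 * (norm (f x))\<^sup>2 + 2 * (norm (g x))\<^sup>2)"
      using i by simp
    show "AE x in lebesgue_on \<Omega>. norm ((norm (f x - g x))\<^sup>2)
        \<le> norm (2 * (norm (f x))\<^sup>2 + 2 * (norm (g x))\<^sup>2)"
      by (intro AE_I2) (simp add: norm_diff_power2_le)
  qed measurable
  then show ?thesis by (simp add: L2_def)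
qed

lemma L2_scaleR:
  fixes f :: "'a::euclidean_space \<Rightarrow> 'b::euclidean_space"
  assumes "f \<in> L2 \<Omega>"
  shows "(\<lambda>x. c *\<^sub>R f x) \<in> L2 \<Omega>"
  using assms by (auto simp: L2_def power_mult_distrib)

lemma L2_integrable_inner:
  fixes f g :: "'a::euclidean_space \<Rightarrow> 'b::euclidean_space"
  assumes "f \<in> L2 \<Omega>" "g \<in> L2 \<Omega>"
  shows "integrable (lebesgue_on \<Omega>) (\<lambda>x. f x \<bullet> g x)"
proof -
  \<comment> \<open>Polarization reduces the product to three squares whose integrability is already
    known.\<close>
  have eq: "f x \<bullet> g x = ((norm (f x))\<^sup>2 + (norm (g x))\<^sup>2 - (norm (f x - g x))\<^sup>2) / 2" for x
    by (simp add: power2_norm_eq_inner inner_diff_left inner_diff_right inner_commute)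
  have "integrable (lebesgue_on \<Omega>) (\<lambda>x. (norm (f x - g x))\<^sup>2)"
    using L2_diff[OF assms] by (simp add: L2_def)
  then show ?thesis
    unfolding eq using assms by (simp add: L2_def)
qed

lemma L2_norm_power2: "(L2_norm \<Omega> f)\<^sup>2 = L2_inner \<Omega> f f"
  unfolding L2_norm_def L2_inner_def by (simp add: integral_nonneg_AE)

text \<open>A squared form of the triangle inequality through \<open>q\<close>, obtained by
  integrating a pointwise bound. The factor 2 is harmless because the estimate serves only where
  both terms on the right tend to 0.\<close>

lemma L2_dist_power2_le:
  fixes a b q :: "'a::euclidean_space \<Rightarrow> 'b::euclidean_space"
  assumes "a \<in> L2 \<Omega>" "b \<in> L2 \<Omega>" "q \<in> L2 \<Omega>"
  shows "(L2_dist \<Omega> a b)\<^sup>2 \<le> 2 * (L2_dist \<Omega> q a)\<^sup>2 + 2 * (L2_dist \<Omega> q b)\<^sup>2"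
proof -
  have i: "integrable (lebesgue_on \<Omega>) (\<lambda>x. (f x - g x) \<bullet> (f x - g x))"
    if "f \<in> L2 \<Omega>" "g \<in> L2 \<Omega>" for f g :: "'a \<Rightarrow> 'b"
    by (intro L2_integrable_inner L2_diff that)
  \<comment> \<open>Here \<open>a x - b x\<close> is the difference of \<open>q x - b x\<close> and
    \<open>q x - a x\<close>.\<close>
  have p: "(a x - b x) \<bullet> (a x - b x) \<le> 2 * ((q x - a x) \<bullet> (q x - a x)) + 2 * ((q x - b x) \<bullet> (q x - b x))" for x
    using norm_diff_power2_le[of "q x - b x" "q x - a x"]
    by (simp add: power2_norm_eq_inner)
  have "(\<integral>x. (a x - b x) \<bullet> (a x - b x) \<partial>lebesgue_on \<Omega>)
     \<le> (\<integral>x. 2 * ((q x - a x) \<bullet> (q x - a x)) + 2 * ((q x - b x) \<bullet> (q x - b x)) \<partial>lebesgue_on \<Omega>)"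
    by (intro integral_mono p Bochner_Integration.integrable_add integrable_mult_right i assms)
  also have "\<dots> = 2 * (\<integral>x. (q x - a x) \<bullet> (q x - a x) \<partial>lebesgue_on \<Omega>)
                + 2 * (\<integral>x. (q x - b x) \<bullet> (q x - b x) \<partial>lebesgue_on \<Omega>)"
    using i assms by simp
  finally show ?thesis
    by (simp add: L2_dist_def L2_norm_power2 L2_inner_def)
qed

lemma L2_dist_AE_eq:
  assumes "AE x in lebesgue_on \<Omega>. f x = g x"
  shows "L2_dist \<Omega> f g = 0"
proof -
  have "(\<integral>x. (f x - g x) \<bullet> (f x - g x) \<partial>lebesgue_on \<Omega>) = 0"
    by (rule integral_eq_zero_AE) (use assms in auto)
  then show ?thesis by (simp add: L2_dist_def L2_norm_def L2_inner_def)
qed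

text \<open>Passing to the limit in the squared triangle inequality leaves only 0 on the right. For
  a pseudometric, uniqueness can mean no more than distance 0.\<close>

lemma L2_limit_unique:
  fixes a b :: "'a::euclidean_space \<Rightarrow> 'b::euclidean_space"
  assumes "A \<noteq> bot" "\<forall>\<^sub>F s in A. q s \<in> L2 \<Omega>" "a \<in> L2 \<Omega>" "b \<in> L2 \<Omega>"
    and "((\<lambda>s. L2_dist \<Omega> (q s) a) \<longlongrightarrow> 0) A" "((\<lambda>s. L2_dist \<Omega> (q s) b) \<longlongrightarrow> 0) A"
  shows "L2_dist \<Omega> a b = 0"
proof -
  have "((\<lambda>s. 2 * (L2_dist \<Omega> (q s) a)\<^sup>2 + 2 * (L2_dist \<Omega> (q s) b)\<^sup>2) \<longlongrightarrow> 2 * 0\<^sup>2 + 2 * 0\<^sup>2) A"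
    by (intro tendsto_intros assms)
  moreover have "\<forall>\<^sub>F s in A. (L2_dist \<Omega> a b)\<^sup>2 \<le> 2 * (L2_dist \<Omega> (q s) a)\<^sup>2 + 2 * (L2_dist \<Omega> (q s) b)\<^sup>2"
    using assms(2) by eventually_elim (intro L2_dist_power2_le assms)
  ultimately have "(L2_dist \<Omega> a b)\<^sup>2 \<le> 2 * 0\<^sup>2 + 2 * 0\<^sup>2"
    using assms(1) by (intro tendsto_lowerbound)
  then show ?thesis by simp
qed

text \<open>The two sets may differ because one derivative is given on the whole lifespan of the
  solution and the other only on some \<open>{0..T}\<close>. On the smaller set \<open>K\<close>
  both are limits of the same quotients.\<close>

lemma L2_time_derivative_unique:
  assumes "has_time_derivative (L2 \<Omega>) (L2_dist \<Omega>) J u v"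
    and "has_time_derivative (L2 \<Omega>) (L2_dist \<Omega>) K u w"
    and "K \<subseteq> J" "t \<in> K" "t islimpt K"
  shows "L2_dist \<Omega> (v t) (w t) = 0"
proof (rule L2_limit_unique)
  show "at t within K \<noteq> bot"
    using assms(5) by (simp add: trivial_limit_within)
  show "((\<lambda>s. L2_dist \<Omega> (\<lambda>x. (u s x - u t x) / (s - t)) (v t)) \<longlongrightarrow> 0) (at t within K)"
    using assms(1,3,4) tendsto_within_subset unfolding has_time_derivative_def by blast
  show "((\<lambda>s. L2_dist \<Omega> (\<lambda>x. (u s x - u t x) / (s - t)) (w t)) \<longlongrightarrow> 0) (at t within K)"
    using assms(2,4) by (simp add: has_time_derivative_def)
  show "v t \<in> L2 \<Omega>" "w t \<in> L2 \<Omega>"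
    using assms by (auto simp: has_time_derivative_def)
  \<comment> \<open>This covers \<open>s = t\<close> too, where division by 0 makes the quotient the
    zero function.\<close>
  have "(\<lambda>x. (u s x - u t x) / (s - t)) \<in> L2 \<Omega>" if "s \<in> K" for s
    using L2_scaleR[OF L2_diff[of "u s" \<Omega> "u t"], of "inverse (s - t)"] that assms(2,4)
    by (simp add: has_time_derivative_def field_simps)
  then show "\<forall>\<^sub>F s in at t within K. (\<lambda>x. (u s x - u t x) / (s - t)) \<in> L2 \<Omega>"
    by (auto simp: eventually_at_filter)
qed

section \<open>Continuous functions, test functions and gradients\<close>

lemma continuous_in_L2:
  fixes f :: "'a::euclidean_space \<Rightarrow> 'b::euclidean_space"
  assumes "continuous_on UNIV f" "open \<Omega>" "bounded \<Omega>"
  shows "f \<in> L2 \<Omega>"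
proof -
  have "compact (f ` closure \<Omega>)"
    using assms by (intro compact_continuous_image) (auto intro: continuous_on_subset)
  then obtain B where B: "\<And>x. x \<in> \<Omega> \<Longrightarrow> norm (f x) \<le> B"
    using closure_subset by (metis bounded_iff compact_imp_bounded image_eqI subsetD)
  have "\<Omega> \<in> lmeasurable"
    using assms by (simp add: lmeasurable_open)
  then interpret finite_measure "lebesgue_on \<Omega>"
    by (rule finite_measure_lebesgue_on)
  have "f \<in> borel_measurable borel"
    using assms(1) by (rule borel_measurable_continuous_onI)
  then have f [measurable]: "f \<in> borel_measurable (lebesgue_on \<Omega>)"
    by (intro measurable_restrict_space1 measurable_completion) simp
  have "integrable (lebesgue_on \<Omega>) (\<lambda>x. (norm (f x))\<^sup>2)"
    by (rule integrable_const_bound[where B = "B\<^sup>2"])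
      (auto simp: space_restrict_space intro!: AE_I2 power_mono B)
  with f show ?thesis by (simp add: L2_def)
qed

text \<open>Smoothness passes to derivatives by the recursion of \<open>C_k\<close>, and off its
  closed support the function is locally 0, so its derivative vanishes there as well. Hence the
  components of a gradient can themselves serve as test functions.\<close>

lemma test_function_partial_derivative:
  assumes "\<phi> \<in> test_functions \<Omega>" "i \<in> Basis"
  shows "(\<lambda>x. frechet_derivative \<phi> (at x) i) \<in> test_functions \<Omega>"
proof -
  let ?d = "\<lambda>x. frechet_derivative \<phi> (at x) i"
  have \<phi>: "C_k k \<phi>" for k
    using assms(1) by (simp add: test_functions_def)
  have "C_k k ?d" for k
    using \<phi>[of "Suc k"] assms(2) by simp
  moreover have "{x. ?d x \<noteq> 0} \<subseteq> closure {x. \<phi> x \<noteq> 0}"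
  proof (rule subsetI, rule ccontr)
    fix x assume x: "x \<in> {x. ?d x \<noteq> 0}" "x \<notin> closure {x. \<phi> x \<noteq> 0}"
    have "(\<phi> has_derivative (\<lambda>h. 0)) (at x)"
    proof (rule has_derivative_transform_within_open)
      show "((\<lambda>x. 0) has_derivative (\<lambda>h. 0)) (at x)" by simp
      show "open (- closure {x. \<phi> x \<noteq> 0})" by (rule open_Compl[OF closed_closure])
      show "0 = \<phi> y" if "y \<in> - closure {x. \<phi> x \<noteq> 0}" for y
        using that closure_subset[of "{x. \<phi> x \<noteq> 0}"] by auto
    qed (use x in auto)
    then have "frechet_derivative \<phi> (at x) = (\<lambda>h. 0)"
      by (metis frechet_derivative_at)
    with x show False by simp
  qed
  then have sub: "closure {x. ?d x \<noteq> 0} \<subseteq> closure {x. \<phi> x \<noteq> 0}"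
    by (simp add: closure_minimal)
  moreover have "compact (closure {x. \<phi> x \<noteq> 0} \<inter> closure {x. ?d x \<noteq> 0})"
    by (rule compact_Int_closed) (use assms(1) in \<open>simp_all add: test_functions_def\<close>)
  then have "compact (closure {x. ?d x \<noteq> 0})"
    by (simp only: Int_absorb1[OF sub])
  ultimately show ?thesis
    using assms(1) unfolding test_functions_def by blast
qed

lemma gradient_inner_Basis: "i \<in> Basis \<Longrightarrow> gradient \<phi> x \<bullet> i = frechet_derivative \<phi> (at x) i"
  by (simp add: gradient_def inner_sum_left inner_Basis if_distrib cong: if_cong)

lemma gradient_continuous:
  assumes "\<phi> \<in> test_functions \<Omega>"
  shows "continuous_on UNIV (gradient \<phi>)"
proof -
  have "C_k 0 (\<lambda>x. frechet_derivative \<phi> (at x) i)" if "i \<in> Basis" for i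
    using test_function_partial_derivative[OF assms that] unfolding test_functions_def by blast
  then show ?thesis
    unfolding gradient_def by (intro continuous_intros) simp
qed

section \<open>Functions vanishing almost everywhere and their weak gradients\<close>

lemma zero_test_function: "(\<lambda>x. 0) \<in> test_functions \<Omega>"
proof -
  have "C_k k (\<lambda>x::'a. 0)" for k
    by (induction k) auto
  then show ?thesis by (simp add: test_functions_def)
qed

lemma gradient_zero: "gradient (\<lambda>x. 0) = (\<lambda>x. 0)"
  by (simp add: gradient_def fun_eq_iff)

text \<open>The constant sequence of zero functions approximates \<open>h\<close>, and both sides of
  the weak derivative identity are 0. This provides the witness that makes the choice in
  \<open>weak_gradient\<close> meaningful for \<open>h\<close>.\<close>

lemma H10_gradient_AE_zero:
  assumes "h \<in> L2 \<Omega>" "AE x in lebesgue_on \<Omega>. h x = 0"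
  shows "H10_gradient \<Omega> h (\<lambda>x. 0)"
proof -
  have "L2_inner \<Omega> h (\<lambda>x. gradient \<psi> x \<bullet> i) = 0" for \<psi> i
    unfolding L2_inner_def by (rule integral_eq_zero_AE) (use assms(2) in auto)
  then have "H1_gradient \<Omega> h (\<lambda>x. 0)"
    using assms(1) by (simp add: H1_gradient_def L2_def L2_inner_def)
  moreover have "L2_dist \<Omega> (\<lambda>x. 0) h = 0"
    using assms(2) by (intro L2_dist_AE_eq) auto
  moreover have "L2_dist \<Omega> (\<lambda>x. 0::'a) (\<lambda>x. 0) = 0"
    by (intro L2_dist_AE_eq) auto
  ultimately show ?thesis
    unfolding H10_gradient_def
    by (intro conjI exI[of _ "\<lambda>k x. 0"]) (simp_all add: zero_test_function gradient_zero)
qed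

text \<open>
  Instead of using density of test functions in \<open>L\<^sup>2\<close>: the weak gradient \<open>g\<close> is orthogonal to all
  test functions, in particular to the gradients of the test functions which approximate \<open>g\<close>.
\<close>

lemma H10_gradient_AE_zero_norm:
  assumes "open \<Omega>" "bounded \<Omega>" "AE x in lebesgue_on \<Omega>. h x = 0" "H10_gradient \<Omega> h g"
  shows "L2_norm \<Omega> g = 0"
proof -
  have g: "g \<in> L2 \<Omega>"
    and weak: "\<And>\<psi> i. \<psi> \<in> test_functions \<Omega> \<Longrightarrow> i \<in> Basis \<Longrightarrow>
        L2_inner \<Omega> h (\<lambda>x. gradient \<psi> x \<bullet> i) = - L2_inner \<Omega> (\<lambda>x. g x \<bullet> i) \<psi>"
    using assms(4) by (auto simp: H10_gradient_def H1_gradient_def)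
  obtain \<phi> where \<phi>: "\<And>k::nat. \<phi> k \<in> test_functions \<Omega>"
    and lim: "(\<lambda>k. L2_dist \<Omega> (gradient (\<phi> k)) g) \<longlonglongrightarrow> 0"
    using assms(4) by (auto simp: H10_gradient_def)
  \<comment> \<open>As \<open>h\<close> vanishes almost everywhere, the weak derivative identity
    turns into orthogonality.\<close>
  have "L2_inner \<Omega> h (\<lambda>x. gradient \<psi> x \<bullet> i) = 0" for \<psi> i
    unfolding L2_inner_def by (rule integral_eq_zero_AE) (use assms(3) in auto)
  with weak have orth: "L2_inner \<Omega> (\<lambda>x. g x \<bullet> i) \<psi> = 0"
    if "\<psi> \<in> test_functions \<Omega>" "i \<in> Basis" for \<psi> i
    using that by simp
  \<comment> \<open>Since \<open>g\<close> is orthogonal to \<open>gradient (\<phi> k)\<close>,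
    Pythagoras makes the squared distance the sum of the two squared norms.\<close>
  have le: "(L2_norm \<Omega> g)\<^sup>2 \<le> (L2_dist \<Omega> (gradient (\<phi> k)) g)\<^sup>2" for k
  proof -
    let ?d = "gradient (\<phi> k)"
    have d: "?d \<in> L2 \<Omega>"
      using \<phi> assms by (intro continuous_in_L2 gradient_continuous)
    \<comment> \<open>Integrability of each product of components lets the sum over
      \<open>Basis\<close> leave the integral.\<close>
    have int: "integrable (lebesgue_on \<Omega>) (\<lambda>x. (g x \<bullet> i) * (?d x \<bullet> i))" if "i \<in> Basis" for i
    proof -
      have *: "(\<lambda>x. f x \<bullet> i) \<in> L2 \<Omega>" if f: "f \<in> L2 \<Omega>" for f :: "'a \<Rightarrow> 'a"
      proof -
        have m [measurable]: "f \<in> borel_measurable (lebesgue_on \<Omega>)"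
          and n: "integrable (lebesgue_on \<Omega>) (\<lambda>x. (norm (f x))\<^sup>2)"
          using f by (auto simp: L2_def)
        have "integrable (lebesgue_on \<Omega>) (\<lambda>x. (norm (f x \<bullet> i))\<^sup>2)"
          by (rule Bochner_Integration.integrable_bound[OF n])
            (auto intro!: AE_I2 simp: Basis_le_norm abs_le_square_iff[symmetric] \<open>i \<in> Basis\<close>)
        then show ?thesis by (simp add: L2_def)
      qed
      show ?thesis
        using L2_integrable_inner[OF *[OF g] *[OF d]] by simp
    qed
    have "L2_inner \<Omega> g ?d = (\<integral>x. (\<Sum>i\<in>Basis. (g x \<bullet> i) * (?d x \<bullet> i)) \<partial>lebesgue_on \<Omega>)"
      unfolding L2_inner_def by (subst euclidean_inner) simp
    also have "\<dots> = (\<Sum>i\<in>Basis. L2_inner \<Omega> (\<lambda>x. g x \<bullet> i) (\<lambda>x. frechet_derivative (\<phi> k) (at x) i))"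
      using int by (simp add: L2_inner_def gradient_inner_Basis)
    \<comment> \<open>Each partial derivative of \<open>\<phi> k\<close> is a test function, hence
      orthogonal to every component of \<open>g\<close>.\<close>
    also have "\<dots> = 0"
      using orth test_function_partial_derivative[OF \<phi>] by simp
    finally have "L2_inner \<Omega> g ?d = 0" .
    moreover have "(L2_dist \<Omega> ?d g)\<^sup>2 = L2_inner \<Omega> ?d ?d - 2 * L2_inner \<Omega> g ?d + L2_inner \<Omega> g g"
    proof -
      have "(?d x - g x) \<bullet> (?d x - g x) = ?d x \<bullet> ?d x - 2 * (g x \<bullet> ?d x) + g x \<bullet> g x" for x
        by (simp add: inner_diff_left inner_diff_right inner_commute)
      then show ?thesis
        using L2_integrable_inner[OF d d] L2_integrable_inner[OF g d] L2_integrable_inner[OF g g]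
        by (simp add: L2_dist_def L2_norm_power2 L2_inner_def)
    qed
    ultimately show ?thesis
      using zero_le_power2[of "L2_norm \<Omega> ?d"] by (simp add: L2_norm_power2)
  qed
  have "(\<lambda>k. (L2_dist \<Omega> (gradient (\<phi> k)) g)\<^sup>2) \<longlonglongrightarrow> 0\<^sup>2"
    by (intro tendsto_intros lim)
  then have "(L2_norm \<Omega> g)\<^sup>2 \<le> 0\<^sup>2"
    by (rule LIMSEQ_le_const) (use le in blast)
  then show ?thesis by simp
qed

text \<open>The difference vanishes almost everywhere, so it has a gradient in the sense of
  \<open>H10_gradient\<close>. The choice \<open>weak_gradient\<close> is therefore a genuine
  gradient, and any such gradient has norm 0.\<close>

lemma H1_dist_AE_eq:
  assumes "open \<Omega>" "bounded \<Omega>" "f \<in> L2 \<Omega>" "g \<in> L2 \<Omega>" "AE x in lebesgue_on \<Omega>. f x = g x"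
  shows "H1_dist \<Omega> f g = 0"
proof -
  let ?h = "\<lambda>x. f x - g x"
  have h: "AE x in lebesgue_on \<Omega>. ?h x = 0"
    using assms(5) by auto
  have "H10_gradient \<Omega> ?h (weak_gradient \<Omega> ?h)"
    unfolding weak_gradient_def
    using someI[of "H10_gradient \<Omega> ?h", OF H10_gradient_AE_zero[OF L2_diff h]] assms by blast
  from H10_gradient_AE_zero_norm[OF assms(1,2) h this] L2_dist_AE_eq[OF assms(5)]
  show ?thesis by (simp add: H1_dist_def H1_norm_def L2_dist_def)
qed

lemma H10_subset_L2: "H10 \<Omega> \<subseteq> L2 \<Omega>"
  by (auto simp: H10_def H10_gradient_def H1_gradient_def)

section \<open>Continuity with respect to pseudometrics\<close>

lemma continuous_between_eq_of_dist_zero: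
  assumes "continuous_between X d UNIV dist (f :: 'x \<Rightarrow> 'y::metric_space)" "x \<in> X" "y \<in> X" "d y x = 0"
  shows "f y = f x"
proof -
  \<comment> \<open>Distance 0 is below every \<open>\<delta>\<close> that continuity
    provides.\<close>
  have "dist (f y) (f x) < \<epsilon>" if "\<epsilon> > 0" for \<epsilon>
    using assms that unfolding continuous_between_def by metis
  then show ?thesis
    by (metis less_irrefl zero_less_dist_iff)
qed

lemma continuous_between_compose:
  assumes "continuous_between X dX Y dY f" "continuous_between Y dY Z dZ g"
  shows "continuous_between X dX Z dZ (\<lambda>x. g (f x))"
  using assms unfolding continuous_between_def by meson

lemma continuous_between_dist_iff:
  "continuous_between S dist UNIV dist f \<longleftrightarrow> continuous_on S f"
  by (simp add: continuous_between_def continuous_on_iff)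

text \<open>A weak solution brings along its own time derivative, which may vary with
  \<open>T\<close>, whereas \<open>ut\<close> is fixed in advance. Exchanging them moves the point
  of the energy space by distance 0, which \<open>G\<close> cannot detect, so continuity and the
  initial value carry over to \<open>ut\<close>.\<close>

lemma weak_solution_functional:
  assumes "open \<Omega>" "bounded \<Omega>"
    and "(u0, v0) \<in> energy_space \<Omega>"
    and G: "continuous_between (energy_space \<Omega>) (energy_dist \<Omega>) UNIV dist (G :: _ \<Rightarrow> real)"
    and "weak_solution \<Omega> \<nu> \<kappa> F u0 v0 T u"
    and "has_time_derivative (L2 \<Omega>) (L2_dist \<Omega>) J u ut" "{0..T} \<subseteq> J"
  shows "continuous_on {0..T} (\<lambda>t. G (u t, ut t))" "G (u 0, ut 0) = G (u0, v0)"
proof -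
  obtain w where T: "0 < T"
    and w: "has_time_derivative (L2 \<Omega>) (L2_dist \<Omega>) {0..T} u w"
    and uw: "continuous_between {0..T} dist (energy_space \<Omega>) (energy_dist \<Omega>) (\<lambda>t. (u t, w t))"
    and init: "AE x in lebesgue_on \<Omega>. u 0 x = u0 x" "AE x in lebesgue_on \<Omega>. w 0 x = v0 x"
    using assms(5) unfolding weak_solution_def by blast
  have in_H: "(u t, w t) \<in> energy_space \<Omega>" if "t \<in> {0..T}" for t
    using uw that by (simp add: continuous_between_def)
  have eq: "G (u t, ut t) = G (u t, w t)" if t: "t \<in> {0..T}" for t
  proof (rule continuous_between_eq_of_dist_zero[OF G])
    show "(u t, w t) \<in> energy_space \<Omega>" by (rule in_H[OF t])
    have "ut t \<in> L2 \<Omega>"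
      using assms(6,7) t by (auto simp: has_time_derivative_def)
    with in_H[OF t] show "(u t, ut t) \<in> energy_space \<Omega>"
      by (simp add: energy_space_def)
    \<comment> \<open>As \<open>T > 0\<close>, no point of the interval is isolated, so the
      one-sided derivatives at the endpoints are determined too.\<close>
    have "t islimpt {0..T}"
      using t T by simp
    with t have "L2_dist \<Omega> (ut t) (w t) = 0"
      by (intro L2_time_derivative_unique[OF assms(6) w assms(7)])
    \<comment> \<open>Not plain reflexivity: the weak gradient of the zero difference is a choice,
      and only its norm is known to be 0.\<close>
    moreover have "H1_dist \<Omega> (u t) (u t) = 0"
      using w t assms(1,2) by (intro H1_dist_AE_eq) (auto simp: has_time_derivative_def)
    ultimately show "energy_dist \<Omega> (u t, ut t) (u t, w t) = 0"
      by (simp add: energy_dist_def)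
  qed
  have "continuous_on {0..T} (\<lambda>t. G (u t, w t))"
    using continuous_between_compose[OF uw G] by (simp add: continuous_between_dist_iff)
  then show "continuous_on {0..T} (\<lambda>t. G (u t, ut t))"
    by (rule continuous_on_eq) (simp add: eq)
  \<comment> \<open>The initial conditions hold only almost everywhere, so again distance 0 replaces
    equality.\<close>
  have "G (u 0, w 0) = G (u0, v0)"
  proof (rule continuous_between_eq_of_dist_zero[OF G])
    have "u 0 \<in> L2 \<Omega>" "u0 \<in> L2 \<Omega>"
      using in_H[of 0] T assms(3) H10_subset_L2 by (auto simp: energy_space_def)
    then show "energy_dist \<Omega> (u 0, w 0) (u0, v0) = 0"
      using H1_dist_AE_eq[OF assms(1,2) _ _ init(1)] L2_dist_AE_eq[OF init(2)]
      by (simp add: energy_dist_def)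
  qed (use in_H[of 0] T assms(3) in auto)
  then show "G (u 0, ut 0) = G (u0, v0)"
    using eq[of 0] T by simp
qed

section \<open>The first point where positivity of a continuous function fails\<close>

lemma positivity_interval:
  fixes g :: "real \<Rightarrow> real" and \<tau> :: ereal
  assumes "0 < \<tau>" "g 0 > 0" and cont: "\<And>T. 0 < T \<Longrightarrow> ereal T < \<tau> \<Longrightarrow> continuous_on {0..T} g"
  shows "\<exists>\<tau>'::ereal. 0 < \<tau>' \<and> \<tau>' \<le> \<tau> \<and>
    (\<forall>t\<in>initial_interval \<tau>'. g t > 0) \<and>
    (\<forall>I. is_interval I \<and> 0 \<in> I \<and> I \<subseteq> initial_interval \<tau> \<and> (\<forall>t\<in>I. g t > 0)
       \<longrightarrow> I \<subseteq> initial_interval \<tau>') \<and>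
    (\<tau>' < \<tau> \<longrightarrow> \<not> g (real_of_ereal \<tau>') > 0)"
proof (cases "\<forall>t\<in>initial_interval \<tau>. g t > 0")
  case True
  \<comment> \<open>With \<open>\<tau>' = \<tau>\<close>, maximality is immediate and the last
    clause is vacuous.\<close>
  then show ?thesis using assms(1) by (intro exI[of _ \<tau>]) auto
next
  case False
  then obtain b where b: "0 \<le> b" "ereal b < \<tau>" "g b \<le> 0"
    by (auto simp: initial_interval_def not_less)
  with assms(2) have "0 < b"
    by (cases "b = 0") auto
  \<comment> \<open>Collecting all points with \<open>g \<le> 0\<close>, not just the zeros, makes
    \<open>b\<close> a member without an intermediate value argument. Continuity makes the set
    compact, and its least element will be \<open>\<tau>'\<close>.\<close>
  let ?Z = "{0..b} \<inter> g -` {..0}"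
  have "compact ?Z"
    using continuous_closed_preimage[OF cont[OF \<open>0 < b\<close> b(2)], of "{..0}"]
      compact_Int_closed[of "{0..b}" ?Z]
    by simp
  moreover have "b \<in> ?Z" using b by simp
  ultimately obtain s where s: "s \<in> ?Z" "\<And>t. t \<in> ?Z \<Longrightarrow> s \<le> t"
    using compact_attains_inf[of ?Z] by blast
  have "0 < s"
    using s(1) assms(2) by (cases "s = 0") auto
  have pos: "g t > 0" if "0 \<le> t" "t < s" for t
    using s(1) s(2)[of t] that by (force simp: not_less)
  \<comment> \<open>An interval containing 0 and some \<open>t \<ge> s\<close> contains
    \<open>s\<close>, where \<open>g\<close> is not positive.\<close>
  have lt: "t < s" if I: "is_interval I" "0 \<in> I" "\<forall>t\<in>I. g t > 0" "t \<in> I" for I t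
  proof (rule ccontr)
    assume "\<not> t < s"
    with \<open>0 < s\<close> I have "s \<in> I"
      using mem_is_interval_1_I[of I 0 t s] by simp
    with I(3) s(1) show False by auto
  qed
  have "ereal s \<le> \<tau>"
    using s(1) b(2) by (auto intro: order_trans[of _ "ereal b"] less_imp_le)
  with \<open>0 < s\<close> s(1) show ?thesis
    by (intro exI[of _ "ereal s"]) (auto simp: initial_interval_def intro: pos lt)
qed

theorem theorem4p3:
  fixes \<Omega> :: "(real ^ 'n) set"
    and \<nu> \<kappa> :: real
    and u0 v0 :: "real ^ 'n \<Rightarrow> real"
    and F :: "(real ^ 'n \<Rightarrow> real) \<Rightarrow> real ^ 'n \<Rightarrow> real"
    and G :: "(real ^ 'n \<Rightarrow> real) \<times> (real ^ 'n \<Rightarrow> real) \<Rightarrow> real"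
    and \<tau> :: ereal
    and u ut :: "real \<Rightarrow> real ^ 'n \<Rightarrow> real"
  assumes "open \<Omega>" and "connected \<Omega>" and "\<Omega> \<noteq> {}" and "bounded \<Omega>"
    and "convex \<Omega> \<or> C2_domain \<Omega>"
    and "\<nu> > 0" and "\<kappa> > 0"
    and "(u0, v0) \<in> energy_space \<Omega>"
    and "continuous_between (L2 \<Omega>) (L2_dist \<Omega>) (L2 \<Omega>) (L2_dist \<Omega>) F"
    and "\<forall>R. \<exists>C. \<forall>f\<in>L2 \<Omega>. L2_norm \<Omega> f \<le> R \<longrightarrow> L2_norm \<Omega> (F f) \<le> C"
    and "continuous_between (energy_space \<Omega>) (energy_dist \<Omega>) UNIV dist G"
    and "G (u0, v0) > 0"
    and "maximal_solution \<Omega> \<nu> \<kappa> F u0 v0 \<tau> u"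
    and "has_time_derivative (L2 \<Omega>) (L2_dist \<Omega>) (initial_interval \<tau>) u ut"
  shows "\<exists>\<tau>'::ereal. 0 < \<tau>' \<and> \<tau>' \<le> \<tau> \<and>
    (\<forall>t\<in>initial_interval \<tau>'. G (u t, ut t) > 0) \<and>
    (\<forall>I. is_interval I \<and> 0 \<in> I \<and> I \<subseteq> initial_interval \<tau> \<and> (\<forall>t\<in>I. G (u t, ut t) > 0)
       \<longrightarrow> I \<subseteq> initial_interval \<tau>') \<and>
    (\<tau>' < \<tau> \<longrightarrow> \<not> G (u (real_of_ereal \<tau>'), ut (real_of_ereal \<tau>')) > 0)"
proof (rule positivity_interval)
  have sol: "weak_solution \<Omega> \<nu> \<kappa> F u0 v0 T u" if "0 < T" "ereal T < \<tau>" for T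
    using assms(13) that by (simp add: maximal_solution_def)
  have sub: "{0..T} \<subseteq> initial_interval \<tau>" if "ereal T < \<tau>" for T
    using that by (auto simp: initial_interval_def intro: le_less_trans[of _ "ereal T"])
  note * = weak_solution_functional[OF assms(1,4,8,11) sol assms(14) sub]
  show "0 < \<tau>"
    using assms(13) by (simp add: maximal_solution_def)
  \<comment> \<open>One real \<open>T\<close> strictly between 0 and \<open>\<tau>\<close>, which
    exists also when \<open>\<tau>\<close> is infinite, suffices for the initial value.\<close>
  then obtain T where "0 < T" "ereal T < \<tau>"
    using ereal_dense2[of 0 \<tau>] by (auto simp: zero_ereal_def)
  with *(2) assms(12) show "G (u 0, ut 0) > 0" by simp
  show "continuous_on {0..T} (\<lambda>t. G (u t, ut t))" if "0 < T" "ereal T < \<tau>" for T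
    using *(1) that by simp
qed

end
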